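(* Let $\Bbbk$ be a field of characteristic zero, let $A=\Bbbk[x_1,\ldots,x_n]$ be a $\mathbb{Z}$-graded Poisson polynomial algebra with each $x_i$ homogeneous, and let $\delta$ be a graded Poisson derivation of $A$ (of degree $0$). Let ${\mathbf m}$ be the modular derivation of $A$ and let ${\mathbf n}$ be the modular derivation of the graded twist $A^{\delta}$. Then $${\mathbf n}={\mathbf m}+\Big(\sum_{i=1}^n\deg x_i\Big)\,\delta-\operatorname{div}(\delta)\,E .$$
   Context: A $\mathbb{Z}$-graded Poisson algebra is a $\mathbb{Z}$-graded commutative $\Bbbk$-algebra with a Poisson bracket $\{-,-\}$ such that both the multiplication and the bracket are graded of degree $0$, i.e. $\deg\{a,b\}=\deg a+\deg b$ for homogeneous $a,b$. For homogeneous $a$, $|a|=\deg a$. The Euler derivation $E$ is given by $E(a)=|a|\,a$ for homogeneous $a$. A Poisson derivation is a $\Bbbk$-linear derivation $\delta$ of the commutative algebra with $\delta(\{a,b\})=\{\delta(a),b\}+\{a,\delta(b)\}$; it is graded (of degree $0$) if it preserves degrees. The graded twist $A^{\delta}$ is the same commutative graded algebra $A$ with the Poisson bracket $$\{a,b\}_{new}=\{a,b\}+E(a)\delta(b)-\delta(a)E(b).$$ For a derivation $\delta$ of $\Bbbk[x_1,\ldots,x_n]$, the divergence is $\operatorname{div}(\delta)=\sum_{i=1}^n \frac{\partial \delta(x_i)}{\partial x_i}$. The Hamiltonian derivation of $a$ is $H_a=\{a,-\}$, and the modular derivation is ${\mathbf m}(a)=-\operatorname{div}(H_a)$ for all $a\in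 A$ (with respect to the given Poisson bracket). *)

theory Defs
  imports Complex_Main "HOL-Library.Poly_Mapping"
begin

text \<open>
  The polynomial ring over \<open>'k\<close> in finitely many variables, one for each element of
  \<open>'v\<close>: finitely supported maps from exponent vectors to coefficients, with the convolution
  product.  Thus \<open>n\<close> is the cardinality of \<open>'v\<close>.
\<close>

type_synonym ('v, 'k) mpoly = "('v \<Rightarrow>\<^sub>0 nat) \<Rightarrow>\<^sub>0 'k"

definition Const :: "'k::zero \<Rightarrow> ('v, 'k) mpoly"
  where "Const c = Poly_Mapping.single 0 c"

definition Var :: "'v \<Rightarrow> ('v, 'k::zero_neq_one) mpoly"
  where "Var i = Poly_Mapping.single (Poly_Mapping.single i 1) 1"

definition scale :: "'k::comm_ring_1 \<Rightarrow> ('v, 'k) mpoly \<Rightarrow> ('v, 'k) mpoly"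
  where "scale c p = Const c * p"

global_interpretation mpoly: vector_space "scale :: 'k::field \<Rightarrow> ('v, 'k) mpoly \<Rightarrow> ('v, 'k) mpoly"
proof
  fix a b :: 'k and x y :: "('v, 'k) mpoly"
  show "scale a (x + y) = scale a x + scale a y"
    by (simp add: scale_def algebra_simps)
  show "scale (a + b) x = scale a x + scale b x"
    by (simp add: scale_def Const_def single_add algebra_simps)
  show "scale a (scale b x) = scale (a * b) x"
    by (simp add: scale_def Const_def mult_single mult.assoc[symmetric])
  show "scale 1 x = x"
    by (simp add: scale_def Const_def)
qed

text \<open>In the terms with \<open>m i = 0\<close> the subtraction is truncated, but the coefficient vanishes.\<close>

definition partial :: "'v \<Rightarrow> ('v, 'k::comm_ring_1) mpoly \<Rightarrow> ('v, 'k) mpoly"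
  where "partial i p =
    (\<Sum>m\<in>Poly_Mapping.keys p.
       Poly_Mapping.single (m - Poly_Mapping.single i 1)
         (of_nat (Poly_Mapping.lookup m i) * Poly_Mapping.lookup p m))"

definition derivation :: "(('v, 'k::field) mpoly \<Rightarrow> ('v, 'k) mpoly) \<Rightarrow> bool"
  where "derivation D \<longleftrightarrow>
    Vector_Spaces.linear scale scale D \<and> (\<forall>a b. D (a * b) = D a * b + a * D b)"

definition divergence ::
    "(('v::finite, 'k::field) mpoly \<Rightarrow> ('v, 'k) mpoly) \<Rightarrow> ('v, 'k) mpoly"
  where "divergence D = (\<Sum>i\<in>UNIV. partial i (D (Var i)))"

subsection \<open>Gradings\<close>

text \<open>
  A family \<open>G\<close> of subspaces indexed by the integers, where \<open>G d\<close> is the homogeneous part of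
  degree \<open>d\<close>.  A decomposition of \<open>a\<close> is a finitely supported choice of homogeneous components
  summing to \<open>a\<close>; the algebra is the direct sum of the \<open>G d\<close> iff it exists and is unique for
  all \<open>a\<close>.
\<close>

definition decomposition ::
    "(int \<Rightarrow> ('v, 'k::field) mpoly set) \<Rightarrow> ('v, 'k) mpoly \<Rightarrow> (int \<Rightarrow> ('v, 'k) mpoly) \<Rightarrow> bool"
  where "decomposition G a c \<longleftrightarrow>
    (\<forall>d. c d \<in> G d) \<and> finite {d. c d \<noteq> 0} \<and> a = (\<Sum>d | c d \<noteq> 0. c d)"

definition algebra_grading :: "(int \<Rightarrow> ('v, 'k::field) mpoly set) \<Rightarrow> bool"
  where "algebra_grading G \<longleftrightarrow>
    (\<forall>d. mpoly.subspace (G d)) \<and>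
    (\<forall>a. \<exists>!c. decomposition G a c) \<and>
    (\<forall>d e. \<forall>a\<in>G d. \<forall>b\<in>G e. a * b \<in> G (d + e))"

definition homogeneous :: "(int \<Rightarrow> ('v, 'k::field) mpoly set) \<Rightarrow> ('v, 'k) mpoly \<Rightarrow> bool"
  where "homogeneous G a \<longleftrightarrow> (\<exists>d. a \<in> G d)"

text \<open>The degree is meaningful only for nonzero homogeneous elements.\<close>

definition hdeg :: "(int \<Rightarrow> ('v, 'k::field) mpoly set) \<Rightarrow> ('v, 'k) mpoly \<Rightarrow> int"
  where "hdeg G a = (THE d. a \<in> G d)"

definition component ::
    "(int \<Rightarrow> ('v, 'k::field) mpoly set) \<Rightarrow> ('v, 'k) mpoly \<Rightarrow> int \<Rightarrow> ('v, 'k) mpoly"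
  where "component G a = (THE c. decomposition G a c)"

text \<open>
  The linear extension of \<open>a \<mapsto> |a| a\<close> from homogeneous elements to the whole algebra; see
  \<open>euler_homogeneous\<close> below.
\<close>

definition euler :: "(int \<Rightarrow> ('v, 'k::field) mpoly set) \<Rightarrow> ('v, 'k) mpoly \<Rightarrow> ('v, 'k) mpoly"
  where "euler G a = (\<Sum>d | component G a d \<noteq> 0. of_int d * component G a d)"

definition graded_map ::
    "(int \<Rightarrow> ('v, 'k::field) mpoly set) \<Rightarrow> (('v, 'k) mpoly \<Rightarrow> ('v, 'k) mpoly) \<Rightarrow> bool"
  where "graded_map G D \<longleftrightarrow> (\<forall>d. \<forall>a\<in>G d. D a \<in> G d)"

subsection \<open>Poisson structures\<close>

definition poisson_bracket ::
    "(('v, 'k::field) mpoly \<Rightarrow> ('v, 'k) mpoly \<Rightarrow> ('v, 'k) mpoly) \<Rightarrow> bool"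
  where "poisson_bracket br \<longleftrightarrow>
    (\<forall>a. derivation (br a)) \<and>
    (\<forall>b. Vector_Spaces.linear scale scale (\<lambda>a. br a b)) \<and>
    (\<forall>a. br a a = 0) \<and>
    (\<forall>a b c. br a (br b c) + br b (br c a) + br c (br a b) = 0)"

definition graded_poisson_algebra ::
    "(int \<Rightarrow> ('v, 'k::field) mpoly set) \<Rightarrow>
     (('v, 'k) mpoly \<Rightarrow> ('v, 'k) mpoly \<Rightarrow> ('v, 'k) mpoly) \<Rightarrow> bool"
  where "graded_poisson_algebra G br \<longleftrightarrow>
    algebra_grading G \<and> poisson_bracket br \<and>
    (\<forall>d e. \<forall>a\<in>G d. \<forall>b\<in>G e. br a b \<in> G (d + e))"

definition poisson_derivation ::
    "(('v, 'k::field) mpoly \<Rightarrow> ('v, 'k) mpoly \<Rightarrow> ('v, 'k) mpoly) \<Rightarrow>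
     (('v, 'k) mpoly \<Rightarrow> ('v, 'k) mpoly) \<Rightarrow> bool"
  where "poisson_derivation br D \<longleftrightarrow>
    derivation D \<and> (\<forall>a b. D (br a b) = br (D a) b + br a (D b))"

definition twist_bracket ::
    "(int \<Rightarrow> ('v, 'k::field) mpoly set) \<Rightarrow>
     (('v, 'k) mpoly \<Rightarrow> ('v, 'k) mpoly \<Rightarrow> ('v, 'k) mpoly) \<Rightarrow>
     (('v, 'k) mpoly \<Rightarrow> ('v, 'k) mpoly) \<Rightarrow>
     ('v, 'k) mpoly \<Rightarrow> ('v, 'k) mpoly \<Rightarrow> ('v, 'k) mpoly"
  where "twist_bracket G br D a b = br a b + euler G a * D b - D a * euler G b"

definition hamiltonian ::
    "(('v, 'k::field) mpoly \<Rightarrow> ('v, 'k) mpoly \<Rightarrow> ('v, 'k) mpoly) \<Rightarrow>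
     ('v, 'k) mpoly \<Rightarrow> ('v, 'k) mpoly \<Rightarrow> ('v, 'k) mpoly"
  where "hamiltonian br a = (\<lambda>b. br a b)"

definition modular ::
    "(('v::finite, 'k::field) mpoly \<Rightarrow> ('v, 'k) mpoly \<Rightarrow> ('v, 'k) mpoly) \<Rightarrow>
     ('v, 'k) mpoly \<Rightarrow> ('v, 'k) mpoly"
  where "modular br a = - divergence (hamiltonian br a)"

subsection \<open>The choice operators above are well defined\<close>

lemma decomposition_homogeneous:
  assumes "algebra_grading G" "a \<in> G d"
  shows "decomposition G a (\<lambda>e. if e = d then a else 0)"
proof -
  have "0 \<in> G e" for e
    using assms(1) by (simp add: algebra_grading_def mpoly.subspace_0)
  moreover have "{e. (if e = d then a else 0) \<noteq> 0} = (if a = 0 then {} else {d})"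
    by auto
  ultimately show ?thesis
    using assms(2) by (auto simp: decomposition_def)
qed

lemma component_homogeneous:
  assumes "algebra_grading G" "a \<in> G d"
  shows "component G a = (\<lambda>e. if e = d then a else 0)"
  unfolding component_def
proof (rule the1_equality)
  show "\<exists>!c. decomposition G a c"
    using assms(1) by (auto simp: algebra_grading_def)
qed (rule decomposition_homogeneous[OF assms])

lemma euler_homogeneous:
  assumes "algebra_grading G" "a \<in> G d"
  shows "euler G a = of_int d * a"
proof -
  have "{e. (if e = d then a else 0) \<noteq> 0} = (if a = 0 then {} else {d})"
    by auto
  then show ?thesis
    by (simp add: euler_def component_homogeneous[OF assms])
qed

lemma hdeg_homogeneous:
  assumes "algebra_grading G" "a \<in> G d" "a \<noteq> 0"
  shows "hdeg G a = d"
  unfolding hdeg_def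
proof (rule the_equality)
  fix e assume "a \<in> G e"
  then show "e = d"
    using component_homogeneous[OF assms(1) \<open>a \<in> G e\<close>] component_homogeneous[OF assms(1,2)] assms(3)
    by (metis (mono_tags))
qed fact

end

theory Submission
  imports Defs
begin

text \<open>
  A derivation satisfies the chain rule \<open>D a = (\<Sum>i. partial i a * D x\<^sub>i)\<close>.  Applied to the
  derivations \<open>\<delta>\<close> and \<open>E\<close>, it turns the Leibniz expansion of the divergence of
  \<open>E(a) \<delta> - \<delta>(a) E\<close> into \<open>\<delta>(E a) - E(\<delta> a) + E(a) div \<delta> - \<delta>(a) div E\<close>.  Since \<open>\<delta>\<close> preserves
  degrees, it commutes with \<open>E\<close>, and \<open>div E\<close> is the sum of the degrees of the variables.
\<close>

section \<open>Induction principles for polynomials\<close>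

lemma poly_mapping_single_induct [case_names single sum]:
  fixes p :: "'a \<Rightarrow>\<^sub>0 'b::comm_monoid_add"
  assumes single: "\<And>k v. P (Poly_Mapping.single k v)"
    and sum: "\<And>p q. P p \<Longrightarrow> P q \<Longrightarrow> P (p + q)"
  shows "P p"
proof (induction p rule: update_induct)
  case const
  \<comment> \<open>The zero map is a singleton with value \<open>0\<close> at any key;
    \<open>undefined\<close> is an arbitrary choice.\<close>
  show ?case using single[of undefined 0] by simp
next
  case (update f a b)
  \<comment> \<open>The key \<open>a\<close> is fresh, so the update overwrites a zero and amounts
    to adding a singleton.\<close>
  have "Poly_Mapping.update a b f = Poly_Mapping.single a b + f"
    using update(1)
    by (auto intro!: poly_mapping_eqI
        simp: lookup_update lookup_add lookup_single in_keys_iff when_def)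
  then show ?case using sum[OF single update(3)] by simp
qed

text \<open>Constants and variables generate the polynomial ring as a ring. The steps build up
  powers of one variable, then monomials, then terms, then sums.\<close>

lemma mpoly_induct [case_names Const Var add mult]:
  fixes p :: "('v, 'k::comm_ring_1) mpoly"
  assumes Const: "\<And>c. P (Const c)"
    and Var: "\<And>i. P (Var i)"
    and add: "\<And>p q. P p \<Longrightarrow> P q \<Longrightarrow> P (p + q)"
    and mult: "\<And>p q. P p \<Longrightarrow> P q \<Longrightarrow> P (p * q)"
  shows "P p"
proof -
  have 1: "P 1"
    using Const[of 1] by (simp add: Const_def)
  have var_power: "P (Poly_Mapping.single (Poly_Mapping.single i k) 1)" for i k
  proof (induction k)
    case 0
    then show ?case using 1 by simp
  next
    case (Suc k)
    have "Poly_Mapping.single (Poly_Mapping.single i (Suc k)) (1::'k)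
        = Var i * Poly_Mapping.single (Poly_Mapping.single i k) 1"
      by (simp add: Var_def mult_single single_add[symmetric])
    then show ?case using mult[OF Var Suc] by simp
  qed
  have monomial: "P (Poly_Mapping.single m 1)" for m
  \<comment> \<open>The exponent vector is itself a finitely supported map, so the same induction
    applies to it; adding exponents multiplies monomials.\<close>
  proof (induction m rule: poly_mapping_single_induct)
    case (single i k)
    then show ?case by (rule var_power)
  next
    case (sum m n)
    show ?case using mult[OF sum(1,2)] by (simp add: mult_single)
  qed
  show ?thesis
  proof (induction p rule: poly_mapping_single_induct)
    case (single m c)
    show ?case using mult[OF Const[of c] monomial[of m]] by (simp add: Const_def mult_single)
  next
    case (sum p q)
    then show ?case by (intro add)
  qed
qed

section \<open>Partial derivatives\<close>

lemma lookup_partial: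
  "Poly_Mapping.lookup (partial i p) m =
    of_nat (Suc (Poly_Mapping.lookup m i)) * Poly_Mapping.lookup p (m + Poly_Mapping.single i 1)"
proof -
  let ?e = "Poly_Mapping.single i (1::nat)"
  \<comment> \<open>Truncated subtraction of \<open>?e\<close> can be undone only if the exponent at
    \<open>i\<close> is positive. Otherwise the factor \<open>of_nat 0\<close> removes the term, and
    \<open>n\<close> cannot equal \<open>m + ?e\<close>.\<close>
  have eq: "n - ?e = m \<longleftrightarrow> n = m + ?e" if "Poly_Mapping.lookup n i \<noteq> 0" for n
    using that by (auto simp: poly_mapping_eq_iff fun_eq_iff lookup_add lookup_minus lookup_single when_def)
  have "Poly_Mapping.lookup (partial i p) m =
      (\<Sum>n\<in>Poly_Mapping.keys p.
        if n = m + ?e then of_nat (Poly_Mapping.lookup n i) * Poly_Mapping.lookup p n else 0)"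
    unfolding partial_def lookup_sum
  proof (intro sum.cong refl)
    fix n
    show "Poly_Mapping.lookup (Poly_Mapping.single (n - ?e)
          (of_nat (Poly_Mapping.lookup n i) * Poly_Mapping.lookup p n)) m =
        (if n = m + ?e then of_nat (Poly_Mapping.lookup n i) * Poly_Mapping.lookup p n else 0)"
      by (cases "Poly_Mapping.lookup n i = 0")
        (auto simp: eq lookup_single lookup_add when_def simp del: One_nat_def)
  qed
  also have "\<dots> = of_nat (Suc (Poly_Mapping.lookup m i)) * Poly_Mapping.lookup p (m + ?e)"
    by (simp add: sum.delta lookup_add lookup_single in_keys_iff)
  finally show ?thesis .
qed

lemma partial_add: "partial i (p + q) = partial i p + partial i q"
  by (rule poly_mapping_eqI) (simp add: lookup_partial lookup_add algebra_simps)

lemma partial_uminus: "partial i (- p) = - partial i p"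
  by (rule poly_mapping_eqI) (simp add: lookup_partial algebra_simps)

lemma partial_diff: "partial i (p - q) = partial i p - partial i q"
  using partial_add[of i p "- q"] by (simp add: partial_uminus)

lemma partial_single:
  "partial i (Poly_Mapping.single m c) =
    Poly_Mapping.single (m - Poly_Mapping.single i 1) (of_nat (Poly_Mapping.lookup m i) * c)"
  by (cases "c = 0") (simp_all add: partial_def)

lemma partial_Const [simp]: "partial i (Const c) = 0"
  by (simp add: Const_def partial_single)

lemma partial_Var: "partial i (Var j) = (if i = j then 1 else 0)"
  by (simp add: Var_def partial_single lookup_single when_def)

lemma partial_mult_single:
  "partial i (Poly_Mapping.single m c * Poly_Mapping.single n d) =
    partial i (Poly_Mapping.single m c) * Poly_Mapping.single n d +
    Poly_Mapping.single m c * partial i (Poly_Mapping.single n d)"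
proof -
  let ?e = "Poly_Mapping.single i (1::nat)"
  \<comment> \<open>Truncation is harmless when the exponent to be lowered is positive; when it is
    zero, the corresponding Leibniz term has coefficient zero.\<close>
  have l: "m + n - ?e = m - ?e + n" if "Poly_Mapping.lookup m i \<noteq> 0"
    using that by (auto simp: poly_mapping_eq_iff fun_eq_iff lookup_add lookup_minus lookup_single when_def)
  have r: "m + n - ?e = m + (n - ?e)" if "Poly_Mapping.lookup n i \<noteq> 0"
    using that by (auto simp: poly_mapping_eq_iff fun_eq_iff lookup_add lookup_minus lookup_single when_def)
  show ?thesis
  proof (cases "Poly_Mapping.lookup m i = 0"; cases "Poly_Mapping.lookup n i = 0")
    \<comment> \<open>Here both Leibniz terms survive. They sit at the same monomial, so their
      coefficients add up to the exponent of \<open>m + n\<close> at \<open>i\<close>.\<close>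
    assume "Poly_Mapping.lookup m i \<noteq> 0" "Poly_Mapping.lookup n i \<noteq> 0"
    then have "m - ?e + n = m + n - ?e" "m + (n - ?e) = m + n - ?e"
      using l r by auto
    then show ?thesis
      unfolding partial_single mult_single
      by (simp add: lookup_add distrib_left distrib_right mult_ac flip: single_add)
  qed (simp_all add: partial_single mult_single lookup_add l r algebra_simps del: One_nat_def)
qed

text \<open>Both sides are additive in each factor, which reduces the rule to single terms.\<close>

lemma partial_mult: "partial i (p * q) = partial i p * q + p * partial i q"
proof (induction p rule: poly_mapping_single_induct)
  case (single m c)
  show ?case
  proof (induction q rule: poly_mapping_single_induct)
    case (single n d)
    show ?case by (rule partial_mult_single)
  next
    case (sum q r)
    then show ?case by (simp add: distrib_left partial_add)
  qed
next
  case (sum p r)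
  then show ?case by (simp add: distrib_right partial_add)
qed

section \<open>Derivations and the chain rule\<close>

lemma
  assumes "derivation D"
  shows derivation_add: "D (a + b) = D a + D b"
    and derivation_scale: "D (scale c a) = scale c (D a)"
    and derivation_mult: "D (a * b) = D a * b + a * D b"
  using assms by (auto simp: derivation_def Vector_Spaces.linear_iff)

lemma derivation_zero: "derivation D \<Longrightarrow> D 0 = 0"
  using derivation_add[of D 0 0] by simp

lemma derivation_sum: "derivation D \<Longrightarrow> D (\<Sum>x\<in>S. f x) = (\<Sum>x\<in>S. D (f x))"
  by (induction S rule: infinite_finite_induct) (simp_all add: derivation_zero derivation_add)

lemma derivation_Const:
  assumes "derivation D"
  shows "D (Const c) = 0"
proof -
  \<comment> \<open>The Leibniz rule for \<open>1 * 1\<close> gives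
    \<open>D 1 = D 1 + D 1\<close>.\<close>
  have "D 1 = 0"
    using derivation_mult[OF assms, of 1 1] by simp
  then show ?thesis
    using derivation_scale[OF assms, of c 1] by (simp add: scale_def)
qed

text \<open>Turns the integer degrees in \<open>euler\<close> into scalars of the ground ring, so
  that linearity and \<open>partial_Const\<close> apply to them.\<close>

lemma of_int_eq_Const: "of_int d = (Const (of_int d) :: ('v, 'k::comm_ring_1) mpoly)"
proof (induction d rule: int_induct[where k = 0])
  case base
  show ?case by (simp add: Const_def)
next
  case (step1 d)
  then show ?case by (simp add: Const_def single_add)
next
  case (step2 d)
  then show ?case by (simp add: Const_def single_diff)
qed

lemma derivation_of_int_mult:
  "derivation D \<Longrightarrow> D (of_int d * a) = of_int d * D a"
  using derivation_scale[of D "of_int d" a] by (simp add: scale_def of_int_eq_Const)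

text \<open>Both sides are derivations in \<open>p\<close> that vanish on constants and agree on the
  variables, hence agree on everything these generate.\<close>

lemma derivation_chain_rule:
  fixes D :: "('v::finite, 'k::field) mpoly \<Rightarrow> ('v, 'k) mpoly"
  assumes "derivation D"
  shows "D p = (\<Sum>i\<in>UNIV. partial i p * D (Var i))"
proof (induction p rule: mpoly_induct)
  case (Const c)
  show ?case by (simp add: derivation_Const[OF assms])
next
  case (Var j)
  have "(\<Sum>i\<in>UNIV. partial i (Var j) * D (Var i)) = (\<Sum>i\<in>UNIV. if i = j then D (Var i) else 0)"
    by (intro sum.cong) (auto simp: partial_Var)
  then show ?case by simp
next
  case (add p q)
  then show ?case
    by (simp add: derivation_add[OF assms] partial_add distrib_right sum.distrib)
next
  case (mult p q)
  have "D (p * q) = D p * q + p * D q"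
    by (rule derivation_mult[OF assms])
  also have "\<dots> = (\<Sum>i\<in>UNIV. partial i p * D (Var i)) * q + p * (\<Sum>i\<in>UNIV. partial i q * D (Var i))"
    using mult by simp
  also have "\<dots> = (\<Sum>i\<in>UNIV. partial i (p * q) * D (Var i))"
    by (simp add: partial_mult sum_distrib_left sum_distrib_right sum.distrib[symmetric] algebra_simps)
  finally show ?case .
qed

section \<open>The Euler derivation of a grading\<close>

context
  fixes G :: "int \<Rightarrow> ('v, 'k::field) mpoly set"
  assumes G: "algebra_grading G"
begin

lemma homogeneous_decomposition:
  obtains S f where "finite S" "\<And>d. f d \<in> G d" "a = (\<Sum>d\<in>S. f d)"
proof -
  obtain c where "decomposition G a c"
    using G by (metis algebra_grading_def)
  then show ?thesis
    by (intro that[of "{d. c d \<noteq> 0}" c]) (auto simp: decomposition_def)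
qed

text \<open>Uniqueness of decompositions identifies the components of the sum with the
  \<open>f d\<close>. Since \<open>S\<close> may contain degrees with \<open>f d = 0\<close>, index
  sets can be enlarged and summands may cancel.\<close>

lemma euler_sum_homogeneous:
  assumes "finite S" "\<And>d. d \<in> S \<Longrightarrow> f d \<in> G d"
  shows "euler G (\<Sum>d\<in>S. f d) = (\<Sum>d\<in>S. of_int d * f d)"
proof -
  \<comment> \<open>Extending \<open>f\<close> by zero outside \<open>S\<close> produces a
    decomposition in the strict sense, indexed by all integers.\<close>
  define c where "c d = (if d \<in> S then f d else 0)" for d
  have supp: "{d. c d \<noteq> 0} \<subseteq> S"
    by (auto simp: c_def)
  have "0 \<in> G d" for d
    using G by (simp add: algebra_grading_def mpoly.subspace_0)
  moreover have "(\<Sum>d\<in>S. f d) = (\<Sum>d | c d \<noteq> 0. c d)"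
    using assms(1) supp by (intro sum.mono_neutral_cong_right) (auto simp: c_def)
  ultimately have "decomposition G (\<Sum>d\<in>S. f d) c"
    using assms finite_subset[OF supp] by (auto simp: decomposition_def c_def)
  then have "component G (\<Sum>d\<in>S. f d) = c"
    using G unfolding component_def by (intro the1_equality) (auto simp: algebra_grading_def)
  then have "euler G (\<Sum>d\<in>S. f d) = (\<Sum>d | c d \<noteq> 0. of_int d * c d)"
    by (simp add: euler_def)
  also have "\<dots> = (\<Sum>d\<in>S. of_int d * f d)"
    using assms(1) supp by (intro sum.mono_neutral_cong_left) (auto simp: c_def)
  finally show ?thesis .
qed

lemma euler_add: "euler G (a + b) = euler G a + euler G b"
proof -
  obtain S f where f: "finite S" "\<And>d. f d \<in> G d" "a = (\<Sum>d\<in>S. f d)"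
    using homogeneous_decomposition by blast
  obtain T g where g: "finite T" "\<And>d. g d \<in> G d" "b = (\<Sum>d\<in>T. g d)"
    using homogeneous_decomposition by blast
  \<comment> \<open>Both decompositions are padded with zeros to the common index set
    \<open>S \<union> T\<close> and then added degree by degree.\<close>
  let ?f = "\<lambda>d. if d \<in> S then f d else 0"
  let ?g = "\<lambda>d. if d \<in> T then g d else 0"
  have sub: "mpoly.subspace (G d)" for d
    using G by (simp add: algebra_grading_def)
  have fg: "?f d \<in> G d" "?g d \<in> G d" for d
    using f(2) g(2) mpoly.subspace_0[OF sub] by auto
  have a: "a = (\<Sum>d\<in>S \<union> T. ?f d)" and b: "b = (\<Sum>d\<in>S \<union> T. ?g d)"
    unfolding f(3) g(3) using f(1) g(1) by (auto intro!: sum.mono_neutral_cong_left)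
  have "a + b = (\<Sum>d\<in>S \<union> T. ?f d + ?g d)"
    by (simp only: a b sum.distrib)
  also have "euler G \<dots> = (\<Sum>d\<in>S \<union> T. of_int d * (?f d + ?g d))"
    using f(1) g(1) mpoly.subspace_add[OF sub fg] by (intro euler_sum_homogeneous) auto
  also have "\<dots> = (\<Sum>d\<in>S \<union> T. of_int d * ?f d) + (\<Sum>d\<in>S \<union> T. of_int d * ?g d)"
    by (simp only: distrib_left sum.distrib)
  also have "\<dots> = euler G (\<Sum>d\<in>S \<union> T. ?f d) + euler G (\<Sum>d\<in>S \<union> T. ?g d)"
    using f(1) g(1) fg by (intro arg_cong2[of _ _ _ _ "(+)"] euler_sum_homogeneous[symmetric]) auto
  also have "\<dots> = euler G a + euler G b"
    by (simp only: a[symmetric] b[symmetric])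
  finally show ?thesis .
qed

lemma euler_zero: "euler G 0 = 0"
  using euler_add[of 0 0] by simp

lemma euler_sum: "euler G (\<Sum>x\<in>S. f x) = (\<Sum>x\<in>S. euler G (f x))"
  by (induction S rule: infinite_finite_induct) (simp_all add: euler_zero euler_add)

lemma euler_scale: "euler G (scale c a) = scale c (euler G a)"
proof -
  obtain S f where f: "finite S" "\<And>d. f d \<in> G d" "a = (\<Sum>d\<in>S. f d)"
    using homogeneous_decomposition by blast
  have "scale c (f d) \<in> G d" for d
    using G f(2) by (simp add: algebra_grading_def mpoly.subspace_scale)
  then have "euler G (\<Sum>d\<in>S. scale c (f d)) = (\<Sum>d\<in>S. of_int d * scale c (f d))"
    by (intro euler_sum_homogeneous f(1))
  then show ?thesis
    unfolding f(3) euler_sum_homogeneous[OF f(1,2)]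
    by (simp add: scale_def sum_distrib_left mult.left_commute)
qed

lemma euler_mult: "euler G (a * b) = euler G a * b + a * euler G b"
proof -
  obtain S f where f: "finite S" "\<And>d. f d \<in> G d" "a = (\<Sum>d\<in>S. f d)"
    using homogeneous_decomposition by blast
  obtain T g where g: "finite T" "\<And>d. g d \<in> G d" "b = (\<Sum>d\<in>T. g d)"
    using homogeneous_decomposition by blast
  have "f d * g e \<in> G (d + e)" for d e
    using G f(2) g(2) by (simp add: algebra_grading_def)
  \<comment> \<open>On homogeneous factors this is \<open>d + e\<close> distributed over the
    product.\<close>
  then have fg: "euler G (f d * g e) = euler G (f d) * g e + f d * euler G (g e)" for d e
    by (simp add: euler_homogeneous[OF G f(2)] euler_homogeneous[OF G g(2)]
        euler_homogeneous[OF G, of _ "d + e"] algebra_simps)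
  have "euler G (a * b) = (\<Sum>d\<in>S. \<Sum>e\<in>T. euler G (f d * g e))"
    unfolding f(3) g(3) by (simp add: sum_product euler_sum)
  also have "\<dots> = euler G a * b + a * euler G b"
    unfolding f(3) g(3) by (simp add: sum_product euler_sum fg sum.distrib)
  finally show ?thesis .
qed

lemma derivation_euler: "derivation (euler G)"
  by (auto simp: derivation_def Vector_Spaces.linear_iff mpoly.vector_space_axioms
      euler_add euler_scale euler_mult)

text \<open>On the part of degree \<open>d\<close>, which \<open>D\<close> preserves, both
  composites are \<open>D\<close> followed by multiplication by \<open>d\<close>.\<close>

lemma euler_graded_derivation_commute:
  assumes "derivation D" "graded_map G D"
  shows "euler G (D a) = D (euler G a)"
proof -
  obtain S f where f: "finite S" "\<And>d. f d \<in> G d" "a = (\<Sum>d\<in>S. f d)"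
    using homogeneous_decomposition by blast
  have "D (f d) \<in> G d" for d
    using assms(2) f(2) by (simp add: graded_map_def)
  then have "euler G (D (f d)) = D (euler G (f d))" for d
    by (simp add: euler_homogeneous[OF G f(2)] derivation_of_int_mult[OF assms(1)]
        euler_homogeneous[OF G, of _ d])
  then show ?thesis
    unfolding f(3) by (simp add: euler_sum derivation_sum[OF assms(1)])
qed

end

section \<open>Divergence\<close>

lemma divergence_add: "divergence (\<lambda>b. D b + D' b) = divergence D + divergence D'"
  by (simp add: divergence_def partial_add sum.distrib)

lemma divergence_diff: "divergence (\<lambda>b. D b - D' b) = divergence D - divergence D'"
  by (simp add: divergence_def partial_diff sum_subtractf)

text \<open>The product rule yields a sum of \<open>partial i a * D (Var i)\<close>, which the chain
  rule collapses to \<open>D a\<close>.\<close>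

lemma divergence_mult:
  assumes "derivation D"
  shows "divergence (\<lambda>b. a * D b) = D a + a * divergence D"
  by (simp add: divergence_def partial_mult sum.distrib sum_distrib_left
      derivation_chain_rule[OF assms, of a])

text \<open>Ensures that \<open>hdeg\<close> of a homogeneous variable is its actual degree.\<close>

lemma Var_neq_zero: "(Var i :: ('v, 'k::zero_neq_one) mpoly) \<noteq> 0"
proof
  assume "(Var i :: ('v, 'k) mpoly) = 0"
  then have "Poly_Mapping.lookup (Var i :: ('v, 'k) mpoly) (Poly_Mapping.single i 1) = 0"
    by simp
  then show False by (simp add: Var_def)
qed

lemma divergence_euler:
  fixes G :: "int \<Rightarrow> ('v::finite, 'k::field) mpoly set"
  assumes "algebra_grading G" "\<And>i. homogeneous G (Var i)"
  shows "divergence (euler G) = of_int (\<Sum>i\<in>UNIV. hdeg G (Var i))"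
proof -
  have "partial i (euler G (Var i)) = of_int (hdeg G (Var i))" for i
  proof -
    obtain d where d: "Var i \<in> G d"
      using assms(2) by (auto simp: homogeneous_def)
    then have "euler G (Var i) = Const (of_int d) * Var i"
      using euler_homogeneous[OF assms(1)] by (simp add: of_int_eq_Const)
    moreover have "hdeg G (Var i) = d"
      by (rule hdeg_homogeneous[OF assms(1) d Var_neq_zero])
    ultimately show ?thesis
      by (simp add: partial_mult partial_Var of_int_eq_Const)
  qed
  then show ?thesis
    by (simp add: divergence_def)
qed

theorem theorem0p2:
  fixes br :: "('v::finite, 'k::field_char_0) mpoly \<Rightarrow> ('v, 'k) mpoly \<Rightarrow> ('v, 'k) mpoly"
    and G :: "int \<Rightarrow> ('v, 'k) mpoly set"
    and \<delta> :: "('v, 'k) mpoly \<Rightarrow> ('v, 'k) mpoly"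
  assumes "graded_poisson_algebra G br"
    and "\<And>i. homogeneous G (Var i)"
    and "poisson_derivation br \<delta>"
    and "graded_map G \<delta>"
  shows "modular (twist_bracket G br \<delta>) =
    (\<lambda>a. modular br a + of_int (\<Sum>i\<in>UNIV. hdeg G (Var i)) * \<delta> a - divergence \<delta> * euler G a)"
proof
  fix a
  have G: "algebra_grading G" and \<delta>: "derivation \<delta>"
    using assms by (auto simp: graded_poisson_algebra_def poisson_derivation_def)
  note E = derivation_euler[OF G]
  \<comment> \<open>With \<open>a\<close> fixed, the twist adds to \<open>br a\<close> the
    derivations \<open>\<delta>\<close> and \<open>euler G\<close>, with polynomial coefficients
    \<open>euler G a\<close> and \<open>- \<delta> a\<close>.\<close>
  have "divergence (\<lambda>b. twist_bracket G br \<delta> a b) =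
      divergence (br a) + (\<delta> (euler G a) + euler G a * divergence \<delta>)
      - (euler G (\<delta> a) + \<delta> a * divergence (euler G))"
    by (simp only: twist_bracket_def divergence_diff divergence_add
        divergence_mult[OF \<delta>] divergence_mult[OF E])
  \<comment> \<open>The two derivative terms \<open>\<delta> (euler G a)\<close> and
    \<open>euler G (\<delta> a)\<close> cancel by commutation.\<close>
  also have "\<dots> = divergence (br a) + euler G a * divergence \<delta>
      - \<delta> a * of_int (\<Sum>i\<in>UNIV. hdeg G (Var i))"
    by (simp only: euler_graded_derivation_commute[OF G \<delta> assms(4)]
        divergence_euler[OF G assms(2)]) simp
  finally show "modular (twist_bracket G br \<delta>) a =
      modular br a + of_int (\<Sum>i\<in>UNIV. hdeg G (Var i)) * \<delta> a - divergence \<delta> * euler G a"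
    by (simp add: modular_def hamiltonian_def mult.commute)
qed

end
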